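(* For $\mathbb P$-almost all $\omega\in\Omega$ the path $W_\cdot(\omega)$ is monotone in no subinterval of $[0,1]$. In addition, with $$E_n:=\bigcap_{i=0}^{n-1}\big\{\omega\in\Omega\mid W_{\frac{i+1}n}(\omega)-W_{\frac in}(\omega)\ge0\big\},\qquad n\in\mathbb N,$$ for $$\mathfrak m(\omega):=\sup\{n-1\mid n\in\mathbb N,\ \omega\in E_n\}\qquad\text{and}\qquad\mathcal O(\omega):=\#\{n\in\mathbb N\mid\omega\in E_n\}$$ we have $$\mathbb P(\mathcal O\ge k)\le\mathbb P(\mathfrak m\ge k)\le2e^{\frac98}\cdot(3k+1)\cdot2^{-k}\qquad\text{for all }k\ge1.$$
   Context: $W=(W_t)_{t\in[0,1]}$ is a standard scalar Brownian motion on a probability space $(\Omega,\mathcal A,\mathbb P)$; $\mathbb N=\{1,2,\dots\}$.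
   Formalization: The printed inequality P(O≥k) ≤ P(m≥k) fails for k=1 (1/2 against at most 7/16). It is replaced by P(O≥k) ≤ P(m+1≥k), with P(m+1≥k) and P(m≥k) both bounded by 2e^{9/8}(3k+1)2^{-k}, so P(O≥k) also keeps the printed bound. *)

theory Defs
  imports "HOL-Probability.Probability" "HOL-Library.Extended_Nat"
begin

text \<open>
  Standard scalar Brownian motion indexed by the time interval \<open>[0,1]\<close>.  The start in \<open>0\<close> and the
  continuity of the paths are only required almost surely, which covers both usual conventions.
  \<open>normal_density\<close> takes the standard deviation, so an increment over \<open>[s,t]\<close> has variance \<open>t - s\<close>.
\<close>

locale standard_brownian_motion = prob_space M
  for M :: "'a measure" and W :: "real \<Rightarrow> 'a \<Rightarrow> real" +
  assumes random_variable_W: "\<And>t. t \<in> {0..1} \<Longrightarrow> random_variable borel (W t)"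
    and start_zero: "AE \<omega> in M. W 0 \<omega> = 0"
    and indep_increments:
      "\<And>(n::nat) t. \<lbrakk>\<And>i. i \<le> n \<Longrightarrow> t i \<in> {0..1}; \<And>i. i < n \<Longrightarrow> t i < t (Suc i)\<rbrakk> \<Longrightarrow>
         indep_vars (\<lambda>_. borel) (\<lambda>i \<omega>. W (t (Suc i)) \<omega> - W (t i) \<omega>) {..<n}"
    and normal_increments:
      "\<And>s t. \<lbrakk>0 \<le> s; s < t; t \<le> 1\<rbrakk> \<Longrightarrow>
         distributed M lborel (\<lambda>\<omega>. W t \<omega> - W s \<omega>) (normal_density 0 (sqrt (t - s)))"
    and continuous_paths: "AE \<omega> in M. continuous_on {0..1} (\<lambda>t. W t \<omega>)"

definition nondecreasing_on_grid :: "'a measure \<Rightarrow> (real \<Rightarrow> 'a \<Rightarrow> real) \<Rightarrow> nat \<Rightarrow> 'a set" where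
  "nondecreasing_on_grid M W n =
     (\<Inter>i<n. {\<omega> \<in> space M. W (real (i + 1) / real n) \<omega> - W (real i / real n) \<omega> \<ge> 0})"

text \<open>
  In \<open>enat\<close> the supremum of the empty set is \<open>0\<close> and that of an unbounded set is \<open>\<infinity>\<close>.  Because of the
  shift \<open>n - 1\<close>, the number of occurrences is bounded pointwise by \<open>last_index E \<omega> + 1\<close> but in general
  not by \<open>last_index E \<omega>\<close>: if \<open>\<omega>\<close> lies in \<open>E 1\<close> only, then \<open>occurrences E \<omega> = 1\<close> and \<open>last_index E \<omega> = 0\<close>.
\<close>

definition last_index :: "(nat \<Rightarrow> 'a set) \<Rightarrow> 'a \<Rightarrow> enat" where
  "last_index E \<omega> = Sup {enat (n - 1) | n. n \<ge> 1 \<and> \<omega> \<in> E n}"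

definition occurrences :: "(nat \<Rightarrow> 'a set) \<Rightarrow> 'a \<Rightarrow> enat" where
  "occurrences E \<omega> =
     (let N = {n. n \<ge> 1 \<and> \<omega> \<in> E n} in if finite N then enat (card N) else \<infinity>)"

end

theory Submission
  imports Defs
begin

text \<open>
  On a partition into \<open>n\<close> pieces all increments have a prescribed sign with probability \<open>2\<^sup>-\<^sup>n\<close>, being
  independent and symmetric.  Monotonicity on an interval with rational endpoints forces this for
  every \<open>n\<close>, hence is a null event.  The tail bound is the union bound over the geometric series
  \<open>\<Sum>n\<ge>k. 2\<^sup>-\<^sup>n = 2 \<cdot> 2\<^sup>-\<^sup>k\<close>, which is even smaller than the bound claimed.
\<close>

text \<open>A centered normal law is invariant under reflection, so both closed half-lines have the
  same mass. They overlap only in \<open>0\<close>, which is not an atom, so this common mass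
  \<open>p\<close> satisfies \<open>p = 1 - p\<close>.\<close>

lemma (in prob_space) prob_centered_normal_half_line:
  assumes X: "distributed M lborel X (normal_density 0 \<sigma>)" and "\<sigma> > 0"
    and A: "A = {0..} \<or> A = {..0}"
  shows "prob (X -` A \<inter> space M) = 1 / 2"
proof -
  have [measurable]: "random_variable borel X"
    using distributed_measurable[OF X] by simp
  have neg: "distributed M lborel (\<lambda>\<omega>. - X \<omega>) (normal_density 0 \<sigma>)"
    using normal_density_affine[OF X \<open>\<sigma> > 0\<close>, of "-1" 0] by simp
  have "emeasure M ((\<lambda>\<omega>. - X \<omega>) -` {..0} \<inter> space M) = emeasure M (X -` {..0} \<inter> space M)"
    using distributed_emeasure[OF X, of "{..0}"] distributed_emeasure[OF neg, of "{..0}"] by simp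
  moreover have "(\<lambda>\<omega>. - X \<omega>) -` {..0} = X -` {0..}" by auto
  ultimately have sym: "prob (X -` {0..} \<inter> space M) = prob (X -` {..0} \<inter> space M)"
    by (simp add: measure_def)
  \<comment> \<open>A law with a Lebesgue density gives no mass to a single point, so closed and
    open half-lines are interchangeable.\<close>
  have "emeasure M (X -` {0} \<inter> space M)
      = (\<integral>\<^sup>+x. ennreal (normal_density 0 \<sigma> x) * indicator {0} x \<partial>lborel)"
    using distributed_emeasure[OF X, of "{0}"] by simp
  also have "\<dots> = 0" by simp
  finally have zero: "prob (X -` {0} \<inter> space M) = 0"
    by (simp add: measure_def)
  have "prob (X -` {..<0} \<inter> space M) = prob (X -` {..0} \<inter> space M - X -` {0} \<inter> space M)"
    by (rule arg_cong[where f=prob]) auto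
  also have "\<dots> = prob (X -` {..0} \<inter> space M)"
    using zero by (subst finite_measure_Diff) auto
  finally have lt: "prob (X -` {..<0} \<inter> space M) = prob (X -` {..0} \<inter> space M)" .
  have "space M - X -` {0..} \<inter> space M = X -` {..<0} \<inter> space M" by auto
  then have "prob (X -` {..<0} \<inter> space M) = 1 - prob (X -` {0..} \<inter> space M)"
    using prob_compl[of "X -` {0..} \<inter> space M"] by simp
  with sym lt A show ?thesis by auto
qed

context standard_brownian_motion
begin

text \<open>Independence turns the probability into a product of factors 1/2. Arbitrary partitions
  and both signs are allowed, so that the grids on [0,1] and the partitions of a subinterval, for
  either direction of monotonicity, are all covered. For \<open>n = 0\<close> the intersection would
  be \<open>UNIV\<close>, which need not be an event.\<close>

lemma prob_increments_in_half_line: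
  assumes "n \<ge> 1" and t: "\<And>i. i \<le> n \<Longrightarrow> t i \<in> {0..1}" "\<And>i. i < n \<Longrightarrow> t i < t (Suc i)"
    and A: "A = {0..} \<or> A = {..0}"
  shows "(\<Inter>i<n. (\<lambda>\<omega>. W (t (Suc i)) \<omega> - W (t i) \<omega>) -` A \<inter> space M) \<in> events"
    and "prob (\<Inter>i<n. (\<lambda>\<omega>. W (t (Suc i)) \<omega> - W (t i) \<omega>) -` A \<inter> space M) = (1 / 2) ^ n"
proof -
  have [measurable]: "A \<in> sets borel" using A by auto
  have "(\<lambda>\<omega>. W (t (Suc i)) \<omega> - W (t i) \<omega>) -` A \<inter> space M \<in> events" if "i < n" for i
  proof -
    have [measurable]: "random_variable borel (W (t (Suc i)))" "random_variable borel (W (t i))"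
      using that t(1) random_variable_W by auto
    show ?thesis by measurable
  qed
  then show "(\<Inter>i<n. (\<lambda>\<omega>. W (t (Suc i)) \<omega> - W (t i) \<omega>) -` A \<inter> space M) \<in> events"
    using \<open>n \<ge> 1\<close> by (intro sets.finite_INT) (auto simp: lessThan_empty_iff)
  have "prob (\<Inter>i<n. (\<lambda>\<omega>. W (t (Suc i)) \<omega> - W (t i) \<omega>) -` A \<inter> space M)
      = (\<Prod>i<n. prob ((\<lambda>\<omega>. W (t (Suc i)) \<omega> - W (t i) \<omega>) -` A \<inter> space M))"
    using \<open>n \<ge> 1\<close> by (intro indep_varsD_finite[OF indep_increments] t) (auto simp: lessThan_empty_iff)
  also have "\<dots> = (\<Prod>i<n. 1 / 2)"
  proof (rule prod.cong)
    fix i assume "i \<in> {..<n}"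
    with t have "0 \<le> t i" "t i < t (Suc i)" "t (Suc i) \<le> 1" by (auto simp: Suc_le_eq)
    with A show "prob ((\<lambda>\<omega>. W (t (Suc i)) \<omega> - W (t i) \<omega>) -` A \<inter> space M) = 1 / 2"
      by (intro prob_centered_normal_half_line[OF normal_increments]) auto
  qed simp
  finally show "prob (\<Inter>i<n. (\<lambda>\<omega>. W (t (Suc i)) \<omega> - W (t i) \<omega>) -` A \<inter> space M) = (1 / 2) ^ n"
    by simp
qed

lemma sets_prob_nondecreasing_on_grid:
  assumes "n \<ge> 1"
  shows "nondecreasing_on_grid M W n \<in> events"
    and "prob (nondecreasing_on_grid M W n) = (1 / 2) ^ n"
proof -
  have "nondecreasing_on_grid M W n =
      (\<Inter>i<n. (\<lambda>\<omega>. W (real (Suc i) / real n) \<omega> - W (real i / real n) \<omega>) -` {0..} \<inter> space M)"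
    unfolding nondecreasing_on_grid_def by (intro INF_cong) auto
  then show "nondecreasing_on_grid M W n \<in> events"
    and "prob (nondecreasing_on_grid M W n) = (1 / 2) ^ n"
    using prob_increments_in_half_line[of n "\<lambda>i. real i / real n" "{0..}"] assms
    by (auto simp: divide_strict_right_mono)
qed

text \<open>Only a null event containing the monotone paths is needed, so the set of these paths
  itself is never measured.\<close>

lemma AE_not_monotone_on_fixed_interval:
  assumes "0 \<le> a" "a < b" "b \<le> 1"
  shows "AE \<omega> in M. \<not> mono_on {a..b} (\<lambda>t. W t \<omega>) \<and> \<not> antimono_on {a..b} (\<lambda>t. W t \<omega>)"
proof -
  \<comment> \<open>The points \<open>t n 0\<close>, ..., \<open>t n n\<close> cut [a,b] into
    \<open>n\<close> equal pieces; in \<open>F A n\<close> all \<open>n\<close> increments lie in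
    \<open>A\<close>.\<close>
  define t where "t n i = a + (b - a) * real i / real n" for n i :: nat
  define F where "F A n = (\<Inter>i<n. (\<lambda>\<omega>. W (t n (Suc i)) \<omega> - W (t n i) \<omega>) -` A \<inter> space M)"
    for A n
  have t_le: "t n i \<in> {a..b}" if "i \<le> n" for n i
  proof -
    have "real i / real n \<in> {0..1}" using that by (auto simp: divide_le_eq_1)
    then have "(b - a) * (real i / real n) \<in> {0..b - a}"
      using assms mult_left_mono[of "real i / real n" 1 "b - a"]
        mult_nonneg_nonneg[of "b - a" "real i / real n"]
      unfolding atLeastAtMost_iff by argo
    then have "a + (b - a) * (real i / real n) \<in> {a..b}"
      unfolding atLeastAtMost_iff by linarith
    then show ?thesis by (simp only: t_def times_divide_eq_right)
  qed
  have t_less: "t n i < t n (Suc i)" if "i < n" for n i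
    using that assms by (auto simp: t_def intro!: divide_strict_right_mono mult_strict_left_mono)
  have F: "F A n \<in> events" "prob (F A n) = (1 / 2) ^ n" if "A = {0..} \<or> A = {..0}" "n \<ge> 1" for A n
  proof -
    have "t n i \<in> {0..1}" if "i \<le> n" for i
      using t_le[OF that] assms by auto
    then show "F A n \<in> events" "prob (F A n) = (1 / 2) ^ n"
      unfolding F_def using that t_less by (intro prob_increments_in_half_line; simp)+
  qed
  \<comment> \<open>The intersection lies in every single \<open>F A n\<close>, so its probability
    is below every power of 1/2.\<close>
  have null: "AE \<omega> in M. \<omega> \<notin> (\<Inter>n\<in>{1..}. F A n)" if A: "A = {0..} \<or> A = {..0}" for A
  proof -
    have meas: "(\<Inter>n\<in>{1..}. F A n) \<in> events"
      using F(1)[OF A] by (intro sets.countable_INT) auto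
    have "prob (\<Inter>n\<in>{1..}. F A n) \<le> (1 / 2) ^ n" if "n \<ge> 1" for n
      using finite_measure_mono[of "\<Inter>n\<in>{1..}. F A n" "F A n"] F[OF A that] that by auto
    moreover have "(\<lambda>n. (1 / 2) ^ n) \<longlonglongrightarrow> (0 :: real)"
      by (rule LIMSEQ_power_zero) simp
    ultimately have "prob (\<Inter>n\<in>{1..}. F A n) \<le> 0"
      by (intro LIMSEQ_le_const) (auto intro: exI[of _ 1])
    then have "(\<Inter>n\<in>{1..}. F A n) \<in> null_sets M"
      using meas by (auto simp: null_sets_def emeasure_eq_measure measure_le_0_iff)
    then show ?thesis by (rule AE_not_in)
  qed
  show ?thesis
    using null[OF disjI1[OF refl]] null[OF disjI2[OF refl]] AE_space
  proof eventually_elim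
    case (elim \<omega>)
    have step: "t n i \<in> {a..b}" "t n (Suc i) \<in> {a..b}" "t n i \<le> t n (Suc i)" if "i < n" for n i
      using that t_le[of i n] t_le[of "Suc i" n] t_less[of i n] by simp_all
    have "\<omega> \<in> F {0..} n" if "mono_on {a..b} (\<lambda>t. W t \<omega>)" for n
    proof -
      have "W (t n i) \<omega> \<le> W (t n (Suc i)) \<omega>" if "i < n" for i
        using \<open>mono_on {a..b} (\<lambda>t. W t \<omega>)\<close> step[OF that] by (rule monotone_onD)
      then show ?thesis using elim(3) by (simp add: F_def)
    qed
    moreover have "\<omega> \<in> F {..0} n" if "antimono_on {a..b} (\<lambda>t. W t \<omega>)" for n
    proof -
      have "W (t n (Suc i)) \<omega> \<le> W (t n i) \<omega>" if "i < n" for i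
        using \<open>antimono_on {a..b} (\<lambda>t. W t \<omega>)\<close> step[OF that] by (rule monotone_onD)
      then show ?thesis using elim(3) by (simp add: F_def)
    qed
    ultimately show "\<not> mono_on {a..b} (\<lambda>t. W t \<omega>) \<and> \<not> antimono_on {a..b} (\<lambda>t. W t \<omega>)"
      using elim by blast
  qed
qed

text \<open>Monotonicity passes to subintervals, and every interval with interior points contains
  one of the countably many intervals with rational endpoints. Hence countably many null sets
  suffice. Nonempty interior rules out the empty set and single points, where every function is
  monotone.\<close>

lemma AE_nowhere_monotone:
  "AE \<omega> in M. \<forall>I. I \<subseteq> {0..1} \<and> is_interval I \<and> interior I \<noteq> {} \<longrightarrow>
     \<not> mono_on I (\<lambda>t. W t \<omega>) \<and> \<not> antimono_on I (\<lambda>t. W t \<omega>)"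
proof -
  define Q where "Q = {(a, b). a \<in> \<rat> \<and> b \<in> \<rat> \<and> 0 \<le> a \<and> a < b \<and> b \<le> (1 :: real)}"
  have "countable Q"
    by (rule countable_subset[of _ "\<rat> \<times> \<rat>"]) (auto simp: Q_def countable_rat)
  then have "AE \<omega> in M. \<forall>(a, b)\<in>Q. \<not> mono_on {a..b} (\<lambda>t. W t \<omega>) \<and> \<not> antimono_on {a..b} (\<lambda>t. W t \<omega>)"
    using AE_not_monotone_on_fixed_interval by (subst AE_ball_countable) (auto simp: Q_def)
  then show ?thesis
  proof (rule AE_mp, intro AE_I2 impI allI)
    fix \<omega> and I :: "real set"
    assume Q: "\<forall>(a, b)\<in>Q. \<not> mono_on {a..b} (\<lambda>t. W t \<omega>) \<and> \<not> antimono_on {a..b} (\<lambda>t. W t \<omega>)"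
      and I: "I \<subseteq> {0..1} \<and> is_interval I \<and> interior I \<noteq> {}"
    \<comment> \<open>Rationals are chosen on both sides of an interior point \<open>x\<close>,
      within distance \<open>e\<close>, so that they span a closed interval inside
      \<open>I\<close>.\<close>
    from I obtain x e where "e > 0" "ball x e \<subseteq> I"
      by (auto simp: mem_interior)
    moreover from \<open>e > 0\<close> obtain a where a: "a \<in> \<rat>" "x - e < a" "a < x"
      using Rats_dense_in_real[of "x - e" x] by auto
    moreover from \<open>e > 0\<close> obtain b where b: "b \<in> \<rat>" "x < b" "b < x + e"
      using Rats_dense_in_real[of x "x + e"] by auto
    ultimately have "{a..b} \<subseteq> I"
      by (auto simp: subset_iff dist_real_def)
    moreover have "(a, b) \<in> Q"
    proof -
      have "a \<in> I" "b \<in> I" using \<open>{a..b} \<subseteq> I\<close> a b by auto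
      then show ?thesis using I a b by (auto simp: Q_def)
    qed
    ultimately show "\<not> mono_on I (\<lambda>t. W t \<omega>) \<and> \<not> antimono_on I (\<lambda>t. W t \<omega>)"
      using Q by (auto intro: monotone_on_subset)
  qed
qed

text \<open>The index \<open>Suc n\<close> absorbs the shift in \<open>last_index\<close>: for
  \<open>k \<ge> 1\<close> this union is the event that \<open>last_index\<close> is at least
  \<open>k\<close>.\<close>

lemma nondecreasing_on_grid_tail:
  shows "(\<Union>n\<in>{k..}. nondecreasing_on_grid M W (Suc n)) \<in> events"
    and "prob (\<Union>n\<in>{k..}. nondecreasing_on_grid M W (Suc n)) \<le> (1 / 2) ^ k"
proof -
  have E: "nondecreasing_on_grid M W (Suc n) \<in> events"
    "prob (nondecreasing_on_grid M W (Suc n)) = (1 / 2) ^ Suc n" for n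
    by (rule sets_prob_nondecreasing_on_grid; simp)+
  show "(\<Union>n\<in>{k..}. nondecreasing_on_grid M W (Suc n)) \<in> events"
    using E(1) by (intro sets.countable_UN) auto
  have "(\<lambda>n. (1 / 2) ^ Suc (n + k)) sums ((1 / 2) ^ k :: real)"
    using sums_mult[OF power_half_series, of "(1 / 2) ^ k"] by (simp add: power_add mult_ac)
  then have s: "(\<lambda>n. prob (nondecreasing_on_grid M W (Suc (n + k)))) sums (1 / 2) ^ k"
    by (simp only: E(2))
  \<comment> \<open>Reindexing over all naturals puts the union in the form required by countable
    subadditivity.\<close>
  have "(\<Union>n\<in>{k..}. nondecreasing_on_grid M W (Suc n)) = (\<Union>n. nondecreasing_on_grid M W (Suc (n + k)))"
    by (auto simp: Bex_def) (metis le_add_diff_inverse2, metis le_add2)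
  also have "prob \<dots> \<le> (\<Sum>n. prob (nondecreasing_on_grid M W (Suc (n + k))))"
    using E(1) s by (intro finite_measure_subadditive_countably) (auto simp: sums_iff)
  finally show "prob (\<Union>n\<in>{k..}. nondecreasing_on_grid M W (Suc n)) \<le> (1 / 2) ^ k"
    using s by (simp add: sums_iff)
qed

end

text \<open>If no index reaches \<open>k\<close>, then \<open>k - 1\<close> is an upper bound, also
  for the empty set. For \<open>k = 0\<close> the left side always holds, whereas the right side may
  fail.\<close>

lemma last_index_ge_iff:
  assumes "k \<ge> 1"
  shows "last_index E \<omega> \<ge> enat k \<longleftrightarrow> (\<exists>n\<ge>k. \<omega> \<in> E (Suc n))"
proof
  assume ge: "last_index E \<omega> \<ge> enat k"
  show "\<exists>n\<ge>k. \<omega> \<in> E (Suc n)"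
  proof (rule ccontr)
    assume none: "\<not> (\<exists>n\<ge>k. \<omega> \<in> E (Suc n))"
    have "n - 1 \<le> k - 1" if "n \<ge> 1" "\<omega> \<in> E n" for n
    proof -
      have "\<not> k \<le> n - 1" using none that by (metis Suc_diff_1 less_le_trans zero_less_one)
      then show ?thesis by simp
    qed
    then have "last_index E \<omega> \<le> enat (k - 1)"
      unfolding last_index_def by (intro Sup_least) auto
    with ge have "enat k \<le> enat (k - 1)" by (rule order_trans)
    with assms show False by simp
  qed
next
  assume "\<exists>n\<ge>k. \<omega> \<in> E (Suc n)"
  then obtain n where n: "n \<ge> k" "\<omega> \<in> E (Suc n)" by blast
  then have "enat n \<le> last_index E \<omega>"
    unfolding last_index_def by (intro Sup_upper) force
  with n(1) show "last_index E \<omega> \<ge> enat k"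
    by (meson enat_ord_simps(1) order_trans)
qed

text \<open>If \<open>last_index E \<omega>\<close> is a finite \<open>m\<close>, all relevant
  indices lie in \<open>{1..Suc m}\<close>; if it is infinite, nothing has to be shown.\<close>

lemma occurrences_le_last_index_Suc: "occurrences E \<omega> \<le> last_index E \<omega> + 1"
proof (cases "last_index E \<omega>")
  case (enat m)
  have "{n. n \<ge> 1 \<and> \<omega> \<in> E n} \<subseteq> {1..Suc m}"
  proof safe
    fix n assume "n \<ge> 1" "\<omega> \<in> E n"
    then have "enat (n - 1) \<le> last_index E \<omega>"
      unfolding last_index_def by (intro Sup_upper) auto
    with \<open>n \<ge> 1\<close> enat show "n \<in> {1..Suc m}" by simp
  qed
  then have "finite {n. n \<ge> 1 \<and> \<omega> \<in> E n}" "card {n. n \<ge> 1 \<and> \<omega> \<in> E n} \<le> Suc m"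
    using card_mono[of "{1..Suc m}"] by (auto intro: finite_subset)
  with enat show ?thesis by (simp add: occurrences_def one_enat_def)
qed simp

text \<open>The comparison is stated with \<open>last_index E \<omega> + 1\<close> because it fails
  for \<open>last_index\<close> itself at \<open>k = 1\<close>: every \<open>E n\<close> with
  \<open>n \<ge> 1\<close> lies in \<open>E 1\<close>, so some occurrence has probability 1/2, while
  the union of the \<open>E n\<close> with \<open>n \<ge> 2\<close> has probability below 1/2, since
  \<open>E 4\<close> is contained in \<open>E 2\<close>. The bound on the tail holds for both
  versions.\<close>

theorem theorem7:
  fixes M :: "'a measure" and W :: "real \<Rightarrow> 'a \<Rightarrow> real"
  assumes "standard_brownian_motion M W"
  shows "(AE \<omega> in M. \<forall>I. I \<subseteq> {0..1} \<and> is_interval I \<and> interior I \<noteq> {} \<longrightarrow>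
            \<not> mono_on I (\<lambda>t. W t \<omega>) \<and> \<not> antimono_on I (\<lambda>t. W t \<omega>)) \<and>
         (let E = nondecreasing_on_grid M W in
            \<forall>k::nat. k \<ge> 1 \<longrightarrow>
              measure M {\<omega> \<in> space M. occurrences E \<omega> \<ge> enat k}
                \<le> measure M {\<omega> \<in> space M. last_index E \<omega> + 1 \<ge> enat k} \<and>
              measure M {\<omega> \<in> space M. last_index E \<omega> + 1 \<ge> enat k}
                \<le> 2 * exp (9 / 8) * (3 * real k + 1) * 2 powr (- real k) \<and>
              measure M {\<omega> \<in> space M. last_index E \<omega> \<ge> enat k}
                \<le> 2 * exp (9 / 8) * (3 * real k + 1) * 2 powr (- real k))"
proof -
  interpret standard_brownian_motion M W by fact
  define E where "E = nondecreasing_on_grid M W"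
  have "measure M {\<omega> \<in> space M. occurrences E \<omega> \<ge> enat k}
          \<le> measure M {\<omega> \<in> space M. last_index E \<omega> + 1 \<ge> enat k} \<and>
        measure M {\<omega> \<in> space M. last_index E \<omega> + 1 \<ge> enat k}
          \<le> 2 * exp (9 / 8) * (3 * real k + 1) * 2 powr (- real k) \<and>
        measure M {\<omega> \<in> space M. last_index E \<omega> \<ge> enat k}
          \<le> 2 * exp (9 / 8) * (3 * real k + 1) * 2 powr (- real k)" if "k \<ge> 1" for k :: nat
  proof -
    have sub: "E (Suc n) \<subseteq> space M" for n
      by (auto simp: E_def nondecreasing_on_grid_def)
    \<comment> \<open>For \<open>k = 1\<close> the condition is void and gives the whole space, not
      the union from \<open>0\<close> on. For \<open>k \<ge> 2\<close> it reads
      \<open>last_index E \<omega> \<ge> k - 1\<close> with \<open>k - 1 \<ge> 1\<close>, as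
      \<open>last_index_ge_iff\<close> requires.\<close>
    have Suc_set: "{\<omega> \<in> space M. last_index E \<omega> + 1 \<ge> enat k} =
        (if k = 1 then space M else (\<Union>n\<in>{k - 1..}. E (Suc n)))"
    proof (cases "k = 1")
      case False
      with that obtain j where k: "k = Suc j" "j \<ge> 1" by (cases k) auto
      have "last_index E \<omega> + 1 \<ge> enat k \<longleftrightarrow> last_index E \<omega> \<ge> enat j" for \<omega>
        by (cases "last_index E \<omega>") (auto simp: k one_enat_def)
      with k sub show ?thesis by (auto simp: last_index_ge_iff)
    qed (simp add: one_enat_def[unfolded One_nat_def, symmetric])
    have meas: "{\<omega> \<in> space M. last_index E \<omega> + 1 \<ge> enat k} \<in> events"
      unfolding Suc_set using nondecreasing_on_grid_tail(1) by (simp add: E_def)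
    \<comment> \<open>The claimed bound exceeds \<open>2 * 2 powr (- real k)\<close> by this factor,
      which is at least 4.\<close>
    have "1 * 4 \<le> exp (9 / 8) * (3 * real k + 1)"
      using that by (intro mult_mono) auto
    then have "2 * 2 powr (- real k) \<le> 2 * (exp (9 / 8) * (3 * real k + 1)) * 2 powr (- real k)"
      by (intro mult_right_mono) auto
    moreover have "2 * 2 powr (- real k) = (1 / 2) ^ (k - 1)"
    proof -
      have "2 powr (- real k) = (1 / 2) ^ k"
        by (simp add: powr_minus powr_realpow power_one_over inverse_eq_divide)
      also have "\<dots> = 1 / 2 * (1 / 2) ^ (k - 1)"
        using that by (intro power_eq_if[THEN trans]) simp
      finally show ?thesis by simp
    qed
    ultimately have bound:
        "(1 / 2) ^ (k - 1) \<le> 2 * exp (9 / 8) * (3 * real k + 1) * 2 powr (- real k)"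
      by (simp only: mult.assoc)
    \<comment> \<open>In the case \<open>k = 1\<close> the right side is 1 and the bound is
      trivial.\<close>
    have "prob {\<omega> \<in> space M. last_index E \<omega> + 1 \<ge> enat k} \<le> (1 / 2) ^ (k - 1)"
      unfolding Suc_set using nondecreasing_on_grid_tail(2)[of "k - 1"] by (simp add: E_def)
    moreover have "prob {\<omega> \<in> space M. last_index E \<omega> \<ge> enat k}
        \<le> prob {\<omega> \<in> space M. last_index E \<omega> + 1 \<ge> enat k}"
      by (intro finite_measure_mono meas) (auto intro: order_trans)
    moreover have "prob {\<omega> \<in> space M. occurrences E \<omega> \<ge> enat k}
        \<le> prob {\<omega> \<in> space M. last_index E \<omega> + 1 \<ge> enat k}"
      by (intro finite_measure_mono meas)
        (auto intro: order_trans[OF _ occurrences_le_last_index_Suc])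
    ultimately show ?thesis using bound by linarith
  qed
  then show ?thesis
    using AE_nowhere_monotone by (simp add: Let_def E_def)
qed

end
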